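(* Let $A$ be a closed densely defined symmetric operator with equal deficiency indices in a separable Hilbert space $\mathfrak H$, let $\{\mathcal H,\Gamma_0,\Gamma_1\}$ be a boundary triplet for $A^*$ with Weyl function $M(z)$, let $A_0=A^*|_{\ker\Gamma_0}$, and let $B_1,B_2\in\mathcal C(\mathcal H)$ be such that $A_{B_1}$ and $A_{B_2}$ are almost solvable extensions of $A$ with a common regular point $z\in\rho(A_{B_1})\cap\rho(A_{B_2})$, $z\in\rho(A_0)$. Then $$(A_{B_1}-z)^{-1}-(A_{B_2}-z)^{-1}\in\mathfrak S(\mathfrak H)\iff (B_1-M(z))^{-1}-(B_2-M(z))^{-1}\in\mathfrak S(\mathcal H).$$
   Context: $[\mathcal H]$ denotes the bounded everywhere defined operators, and $\mathcal C(\mathcal H)$ the closed densely defined operators in $\mathcal H$. A boundary triplet for $A^*$ is a triple $\{\mathcal H,\Gamma_0,\Gamma_1\}$, where $\mathcal H$ is a Hilbert space and $\Gamma_0,\Gamma_1:\operatorname{dom}(A^* )\to\mathcal H$ are linear maps such that (i) $(A^*f,g)_{\mathfrak H}-(f,A^*g)_{\mathfrak H}=(\Gamma_1f,\Gamma_0g)_{\mathcal H}-(\Gamma_0f,\Gamma_1g)_{\mathcal H}$ for all $f,g\in\operatorname{dom}(A^* )$, and (ii) $f\mapsto(\Gamma_1f,\Gamma_0f)$ maps $\operatorname{dom}(A^* )$ onto $\mathcal H\oplus\mathcal H$. For $B\in\mathcal C(\mathcal H)$, $A_B$ is the restriction of $A^*$ to $\{f\in\operatorname{dom}(A^* ):\Gamma_0f\in\operatorname{dom}(B),\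 \Gamma_1f=B\Gamma_0f\}$. The operator $A_0=A^*|_{\ker\Gamma_0}$ is self-adjoint, and the Weyl function is the $[\mathcal H]$-valued function $M(z)$, $z\in\rho(A_0)$, defined by $M(z)\Gamma_0f_z=\Gamma_1f_z$ for $f_z\in\mathfrak N_z=\ker(A^*-z)$. For $z\in\rho(A_0)\cap\rho(A_B)$ one has $(B-M(z))^{-1}\in[\mathcal H]$. A proper extension $\widetilde A$ ($A\subset\widetilde A\subset A^*$) is almost solvable if $\operatorname{dom}(\widetilde A)=\{f:\Gamma_1'f=B'\Gamma_0'f\}$ for some boundary triplet $\{\mathcal H',\Gamma_0',\Gamma_1'\}$ for $A^*$ and some $B'\in[\mathcal H']$. $\mathfrak S$ denotes a two-sided operator ideal taken on different Hilbert spaces simultaneously: to each separable Hilbert space $\mathcal K$ it assigns a two-sided ideal $\mathfrak S(\mathcal K)$ of $[\mathcal K]$, such that $STR\in\mathfrak S(\mathcal K_2)$ whenever $T\in\mathfrak S(\mathcal K_1)$ and $S:\mathcal K_1\to\mathcal K_2$, $R:\mathcal K_2\to\mathcal K_1$ are bounded. *)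

theory Defs
  imports "HOL-Analysis.Analysis" "HOL-Library.Equipollence"
begin

(* Complex Hilbert spaces.  The norm and the topology are those of the underlying
   real inner product space, whose inner product is the real part of cinner.
   cinner is linear in its first argument. *)

class chilbert_space = real_inner + complete_space +
  fixes scaleC :: "complex \<Rightarrow> 'a \<Rightarrow> 'a" (infixr \<open>*\<^sub>C\<close> 75)
    and cinner :: "'a \<Rightarrow> 'a \<Rightarrow> complex"
  assumes scaleC_add_right: "c *\<^sub>C (x + y) = c *\<^sub>C x + c *\<^sub>C y"
    and scaleC_add_left: "(c + d) *\<^sub>C x = c *\<^sub>C x + d *\<^sub>C x"
    and scaleC_scaleC: "c *\<^sub>C d *\<^sub>C x = (c * d) *\<^sub>C x"
    and scaleR_scaleC: "r *\<^sub>R x = complex_of_real r *\<^sub>C x"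
    and cinner_commute: "cinner x y = cnj (cinner y x)"
    and cinner_add_left: "cinner (x + y) w = cinner x w + cinner y w"
    and cinner_scaleC_left: "cinner (c *\<^sub>C x) y = c * cinner x y"
    and inner_cinner: "inner x y = Re (cinner x y)"


(* [H], extended to two different spaces *)

definition bounded_op :: "('a::chilbert_space \<Rightarrow> 'b::chilbert_space) \<Rightarrow> bool" where
  "bounded_op T \<longleftrightarrow> bounded_linear T \<and> (\<forall>c x. T (c *\<^sub>C x) = c *\<^sub>C T x)"


(* Unbounded operators are identified with their graphs: Domain T is the domain,
   and inclusion of graphs is extension of operators. *)

type_synonym ('a, 'b) graph_op = "('a \<times> 'b) set"

definition linear_op :: "('a::chilbert_space, 'b::chilbert_space) graph_op \<Rightarrow> bool" where
  "linear_op T \<longleftrightarrow> single_valued T \<and> (0, 0) \<in> T \<and>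
     (\<forall>x y x' y'. (x, y) \<in> T \<longrightarrow> (x', y') \<in> T \<longrightarrow> (x + x', y + y') \<in> T) \<and>
     (\<forall>c x y. (x, y) \<in> T \<longrightarrow> (c *\<^sub>C x, c *\<^sub>C y) \<in> T)"

(* the class C(H) *)

definition closed_densely_defined :: "('a::chilbert_space, 'a) graph_op \<Rightarrow> bool" where
  "closed_densely_defined T \<longleftrightarrow> linear_op T \<and> closed T \<and> closure (Domain T) = UNIV"

definition op_adjoint :: "('a::chilbert_space, 'a) graph_op \<Rightarrow> ('a, 'a) graph_op" where
  "op_adjoint T = {(g, g'). \<forall>(f, f') \<in> T. cinner f' g = cinner f g'}"

definition symmetric_op :: "('a::chilbert_space, 'a) graph_op \<Rightarrow> bool" where
  "symmetric_op T \<longleftrightarrow> (\<forall>(f, f') \<in> T. \<forall>(g, g') \<in> T. cinner f' g = cinner f g')"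

definition op_diff :: "('a::chilbert_space, 'a) graph_op \<Rightarrow> ('a, 'a) graph_op \<Rightarrow> ('a, 'a) graph_op" where
  "op_diff S T = {(x, s - t) | x s t. (x, s) \<in> S \<and> (x, t) \<in> T}"

definition scalar_op :: "complex \<Rightarrow> ('a::chilbert_space, 'a) graph_op" where
  "scalar_op z = {(x, z *\<^sub>C x) | x. True}"

(* The inverse as a function; meaningful when the operator is injective and onto. *)

definition op_inv :: "('a::chilbert_space, 'a) graph_op \<Rightarrow> 'a \<Rightarrow> 'a" where
  "op_inv T = (\<lambda>y. THE x. (x, y) \<in> T)"

definition resolvent_set :: "('a::chilbert_space, 'a) graph_op \<Rightarrow> complex set" where
  "resolvent_set T =
     {z. \<exists>R. bounded_op R \<and> (\<forall>x y. (x, y) \<in> op_diff T (scalar_op z) \<longleftrightarrow> x = R y)}"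

definition resolvent :: "('a::chilbert_space, 'a) graph_op \<Rightarrow> complex \<Rightarrow> 'a \<Rightarrow> 'a" where
  "resolvent T z = op_inv (op_diff T (scalar_op z))"


definition defect_space :: "('a::chilbert_space, 'a) graph_op \<Rightarrow> complex \<Rightarrow> 'a set" where
  "defect_space A z = {f. (f, z *\<^sub>C f) \<in> op_adjoint A}"

definition orthonormal_basis_of :: "'a::chilbert_space set \<Rightarrow> 'a set \<Rightarrow> bool" where
  "orthonormal_basis_of E L \<longleftrightarrow> E \<subseteq> L \<and>
     (\<forall>e\<in>E. \<forall>e'\<in>E. cinner e e' = (if e = e' then 1 else 0)) \<and>
     (\<forall>x\<in>L. (\<forall>e\<in>E. cinner x e = 0) \<longrightarrow> x = 0)"

(* The deficiency indices are the Hilbert space dimensions, i.e. the cardinalities of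
   orthonormal bases, of the defect spaces at i and -i. *)

definition equal_deficiency_indices :: "('a::chilbert_space, 'a) graph_op \<Rightarrow> bool" where
  "equal_deficiency_indices A \<longleftrightarrow>
     (\<exists>E F. orthonormal_basis_of E (defect_space A \<i>) \<and>
            orthonormal_basis_of F (defect_space A (- \<i>)) \<and> E \<approx> F)"


(* Boundary triplets for the adjoint of A.  The boundary space is the type 'h; the maps
   are only relevant on the domain of the adjoint. *)

definition linear_map_on :: "'a::chilbert_space set \<Rightarrow> ('a \<Rightarrow> 'h::chilbert_space) \<Rightarrow> bool" where
  "linear_map_on L \<Gamma> \<longleftrightarrow>
     (\<forall>f\<in>L. \<forall>g\<in>L. \<Gamma> (f + g) = \<Gamma> f + \<Gamma> g) \<and> (\<forall>c. \<forall>f\<in>L. \<Gamma> (c *\<^sub>C f) = c *\<^sub>C \<Gamma> f)"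

definition boundary_triplet ::
  "('a::chilbert_space, 'a) graph_op \<Rightarrow> ('a \<Rightarrow> 'h::chilbert_space) \<Rightarrow> ('a \<Rightarrow> 'h) \<Rightarrow> bool" where
  "boundary_triplet A \<Gamma>0 \<Gamma>1 \<longleftrightarrow>
     linear_map_on (Domain (op_adjoint A)) \<Gamma>0 \<and>
     linear_map_on (Domain (op_adjoint A)) \<Gamma>1 \<and>
     (\<forall>(f, f') \<in> op_adjoint A. \<forall>(g, g') \<in> op_adjoint A.
        cinner f' g - cinner f g' = cinner (\<Gamma>1 f) (\<Gamma>0 g) - cinner (\<Gamma>0 f) (\<Gamma>1 g)) \<and>
     (\<lambda>f. (\<Gamma>1 f, \<Gamma>0 f)) ` Domain (op_adjoint A) = UNIV"

(* A_B *)

definition extension_by ::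
  "('a::chilbert_space, 'a) graph_op \<Rightarrow> ('a \<Rightarrow> 'h::chilbert_space) \<Rightarrow> ('a \<Rightarrow> 'h) \<Rightarrow>
   ('h, 'h) graph_op \<Rightarrow> ('a, 'a) graph_op" where
  "extension_by A \<Gamma>0 \<Gamma>1 B = {(f, f') \<in> op_adjoint A. (\<Gamma>0 f, \<Gamma>1 f) \<in> B}"

(* A_0 *)

definition kernel_extension ::
  "('a::chilbert_space, 'a) graph_op \<Rightarrow> ('a \<Rightarrow> 'h::chilbert_space) \<Rightarrow> ('a, 'a) graph_op" where
  "kernel_extension A \<Gamma>0 = {(f, f') \<in> op_adjoint A. \<Gamma>0 f = 0}"

(* M(z), given by its graph: M(z) maps \<Gamma>0 f to \<Gamma>1 f for f in the defect space at z *)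

definition weyl_function ::
  "('a::chilbert_space, 'a) graph_op \<Rightarrow> ('a \<Rightarrow> 'h::chilbert_space) \<Rightarrow> ('a \<Rightarrow> 'h) \<Rightarrow>
   complex \<Rightarrow> ('h, 'h) graph_op" where
  "weyl_function A \<Gamma>0 \<Gamma>1 z = {(\<Gamma>0 f, \<Gamma>1 f) | f. f \<in> defect_space A z}"

(* HOL cannot quantify over the auxiliary boundary space inside a formula, so it is a type
   argument; with a type variable in a premise, the premise is in effect existential in it. *)

definition almost_solvable ::
  "'k::chilbert_space itself \<Rightarrow> ('a::chilbert_space, 'a) graph_op \<Rightarrow> ('a, 'a) graph_op \<Rightarrow> bool" where
  "almost_solvable K A A' \<longleftrightarrow> A \<subseteq> A' \<and> A' \<subseteq> op_adjoint A \<and>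
     (\<exists>(\<Gamma>0 :: 'a \<Rightarrow> 'k) (\<Gamma>1 :: 'a \<Rightarrow> 'k) B. boundary_triplet A \<Gamma>0 \<Gamma>1 \<and> bounded_op B \<and>
        Domain A' = {f \<in> Domain (op_adjoint A). \<Gamma>1 f = B (\<Gamma>0 f)})"


definition two_sided_ideal :: "('a::chilbert_space \<Rightarrow> 'a) set \<Rightarrow> bool" where
  "two_sided_ideal J \<longleftrightarrow> (\<forall>T\<in>J. bounded_op T) \<and> (\<lambda>_. 0) \<in> J \<and>
     (\<forall>T\<in>J. \<forall>T'\<in>J. (\<lambda>x. T x + T' x) \<in> J) \<and>
     (\<forall>T\<in>J. \<forall>S R. bounded_op S \<longrightarrow> bounded_op R \<longrightarrow> S \<circ> T \<circ> R \<in> J)"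

definition ideal_transfer ::
  "('a::chilbert_space \<Rightarrow> 'a) set \<Rightarrow> ('b::chilbert_space \<Rightarrow> 'b) set \<Rightarrow> bool" where
  "ideal_transfer J1 J2 \<longleftrightarrow>
     (\<forall>T\<in>J1. \<forall>(S :: 'a \<Rightarrow> 'b) (R :: 'b \<Rightarrow> 'a).
        bounded_op S \<longrightarrow> bounded_op R \<longrightarrow> S \<circ> T \<circ> R \<in> J2)"

(* An ideal taken on all Hilbert spaces simultaneously cannot be one HOL object, since it
   would be a family over types; J1 and J2 are its members at the spaces 'a and 'b.  Nothing
   is lost: such a pair extends to all spaces K by the sums of operators S T R with
   T in J1 or J2 and bounded R, S from and to K. *)

definition operator_ideal_on ::
  "('a::chilbert_space \<Rightarrow> 'a) set \<Rightarrow> ('b::chilbert_space \<Rightarrow> 'b) set \<Rightarrow> bool" where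
  "operator_ideal_on J1 J2 \<longleftrightarrow>
     two_sided_ideal J1 \<and> two_sided_ideal J2 \<and> ideal_transfer J1 J2 \<and> ideal_transfer J2 J1"

end

theory Submission
  imports Defs
begin

text \<open>Let \<open>R\<^sub>0\<close> be the resolvent of \<open>A\<^sub>0\<close> at \<open>z\<close>, let \<open>\<gamma>\<close> be the inverse of \<open>\<Gamma>\<^sub>0\<close> on the
  defect space at \<open>z\<close>, and let \<open>Q = \<Gamma>\<^sub>1 R\<^sub>0\<close>.  Solving \<open>(A\<^sub>B - z) f = y\<close> by \<open>f = R\<^sub>0 y + \<gamma> h\<close> turns the
  boundary condition into \<open>(B - M(z)) h = Q y\<close>, so the resolvent difference of \<open>A\<^bsub>B1\<^esub>\<close> and \<open>A\<^bsub>B2\<^esub>\<close> is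
  \<open>\<gamma> D Q\<close>, where \<open>D\<close> is the difference of the inverses of \<open>B1 - M(z)\<close> and \<open>B2 - M(z)\<close>.  By the closed
  graph theorem \<open>\<gamma>\<close> and \<open>Q\<close> are bounded; since \<open>\<gamma>\<close> is injective with closed range and \<open>Q\<close> is onto,
  they have a bounded left inverse \<open>L\<close> and a bounded right inverse \<open>S\<close>.  Hence \<open>D\<close> is in turn
  \<open>L\<close> times the resolvent difference times \<open>S\<close>, and the ideal property applies in both directions.\<close>

section \<open>The closed graph theorem\<close>

text \<open>By Baire, some preimage of a ball is dense in a ball, which symmetry and convexity move to
  the origin.\<close>

lemma approx_preimage:
  fixes T :: "'a::banach \<Rightarrow> 'b::real_normed_vector"
  assumes "linear T"
  obtains C where "C \<ge> 0" "\<And>x. \<exists>u. norm (T u) \<le> C * norm x \<and> norm (x - u) \<le> norm x / 2"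
proof -
  interpret linear T by fact
  define K where "K n = closure {x. norm (T x) \<le> real n}" for n
  have "\<exists>n. interior (K n) \<noteq> {}"
  proof (rule ccontr)
    assume "\<nexists>n. interior (K n) \<noteq> {}"
    then have "euclidean interior_of (\<Union> (range K)) = {}"
      by (intro Baire_category_alt disjI1 completely_metrizable_space_euclidean)
        (auto simp: K_def)
    moreover have "\<Union> (range K) = UNIV"
    proof (intro set_eqI iffI UNIV_I)
      fix x
      obtain n where "norm (T x) \<le> real n"
        using real_arch_simple by blast
      then have "x \<in> K n"
        unfolding K_def by (intro subsetD[OF closure_subset]) simp
      then show "x \<in> \<Union> (range K)"
        by blast
    qed
    ultimately show False
      by simp
  qed
  then obtain n x0 where "x0 \<in> interior (K n)"
    by blast
  then obtain r where r: "r > 0" "ball x0 r \<subseteq> K n"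
    by (auto simp: mem_interior)
  define B where "B = {x. norm (T x) \<le> real n}"
  have conv: "convex (K n)"
  proof -
    have "convex (T -` cball 0 (real n))"
      using assms by (intro convex_linear_vimage) auto
    moreover have "T -` cball 0 (real n) = B"
      by (auto simp: B_def)
    ultimately show ?thesis
      by (simp add: K_def convex_closure flip: B_def)
  qed
  have sym: "- x \<in> K n" if "x \<in> K n" for x
  proof -
    have "uminus ` closure B \<subseteq> closure (uminus ` B)"
      by (intro image_closure_subset continuous_intros closure_subset closed_closure)
    moreover have "uminus ` B \<subseteq> B"
      by (auto simp: B_def neg)
    ultimately show ?thesis
      using that closure_mono unfolding K_def B_def[symmetric] by blast
  qed
  have ball: "y \<in> K n" if "norm y < r" for y
  proof -
    \<comment> \<open>\<open>y\<close> is the midpoint of \<open>x0 + y\<close> and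
      \<open>- (x0 - y)\<close>, and both lie in \<open>K n\<close>.\<close>
    have "x0 + y \<in> K n" "x0 - y \<in> K n"
      using that by (auto intro!: subsetD[OF r(2)] simp: dist_norm)
    then have "x0 + y \<in> K n" "- (x0 - y) \<in> K n"
      using sym by blast+
    then have "(1/2) *\<^sub>R (x0 + y) + (1/2) *\<^sub>R (- (x0 - y)) \<in> K n"
      using conv by (intro convexD) auto
    then show ?thesis
      by (simp add: algebra_simps flip: scaleR_left_distrib)
  qed
  show thesis
  proof
    show "2 * real n / r \<ge> 0"
      using r by simp
    fix x
    show "\<exists>u. norm (T u) \<le> 2 * real n / r * norm x \<and> norm (x - u) \<le> norm x / 2"
    proof (cases "x = 0")
      case True
      then show ?thesis
        by (auto intro!: exI[of _ 0])
    next
      case False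
      \<comment> \<open>Rescaling gives \<open>t *\<^sub>R x\<close> the norm \<open>r / 2\<close>,
        which is inside the open ball. An approximation of it within \<open>r / 4\<close>, divided
        by \<open>t\<close>, misses \<open>x\<close> by at most \<open>norm x / 2\<close>.\<close>
      define t where "t = r / (2 * norm x)"
      have t: "t > 0" "t * norm x = r / 2"
        using False r by (auto simp: t_def)
      have "t *\<^sub>R x \<in> K n"
        using t r by (intro ball) auto
      then obtain v where v: "norm (T v) \<le> real n" "dist v (t *\<^sub>R x) < r / 4"
        unfolding K_def closure_approachable using r by (auto dest!: spec[of _ "r/4"])
      have "norm (T (v /\<^sub>R t)) \<le> real n / t"
        using v t by (simp add: scale divide_simps mult.commute)
      also have "real n / t = 2 * real n / r * norm x"
        using False r by (simp add: t_def)
      finally have 1: "norm (T (v /\<^sub>R t)) \<le> 2 * real n / r * norm x" .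
      have "x - v /\<^sub>R t = - ((v - t *\<^sub>R x) /\<^sub>R t)"
        using t by (simp add: scaleR_diff_right)
      then have "norm (x - v /\<^sub>R t) = dist v (t *\<^sub>R x) / t"
        using t by (simp only: dist_norm norm_minus_cancel norm_scaleR) (simp add: field_simps)
      also have "\<dots> \<le> (r / 4) / t"
        using v t by (intro divide_right_mono) auto
      also have "\<dots> = norm x / 2"
        using False r by (simp add: t_def)
      finally show ?thesis
        using 1 by blast
    qed
  qed
qed

text \<open>Iterating the approximation writes \<open>x\<close> as a series whose images under
  \<open>T\<close> are dominated by a geometric series. Completeness of the target sums these
  images, and closedness of the graph identifies the sum with \<open>T x\<close>. The factor 2 in
  the bound is the sum of the powers of 1/2.\<close>

theorem closed_graph:
  fixes T :: "'a::banach \<Rightarrow> 'b::banach"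
  assumes lin: "linear T"
    and closed: "\<And>f x y. f \<longlonglongrightarrow> x \<Longrightarrow> (\<lambda>n. T (f n)) \<longlonglongrightarrow> y \<Longrightarrow> T x = y"
  shows "bounded_linear T"
proof -
  interpret linear T by fact
  obtain C where C: "C \<ge> 0" "\<And>x. \<exists>u. norm (T u) \<le> C * norm x \<and> norm (x - u) \<le> norm x / 2"
    using approx_preimage[OF lin] by blast
  then obtain g where g: "\<And>x. norm (T (g x)) \<le> C * norm x" "\<And>x. norm (x - g x) \<le> norm x / 2"
    by metis
  have "norm (T x) \<le> norm x * (2 * C)" for x
  proof -
    \<comment> \<open>the remainders after successively subtracting approximate preimages\<close>
    define X where "X k = ((\<lambda>x. x - g x) ^^ k) x" for k
    have X: "norm (X k) \<le> norm x * (1/2)^k" for k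
    proof (induction k)
      case (Suc k)
      then show ?case
        using g(2)[of "X k"] by (simp add: X_def)
    qed (simp add: X_def)
    \<comment> \<open>The sum telescopes because \<open>X j - X (Suc j) = g (X j)\<close>.\<close>
    have tele: "T (x - X k) = (\<Sum>j<k. T (g (X j)))" for k
      by (induction k) (auto simp: X_def diff add zero algebra_simps)
    have bound: "norm (T (g (X k))) \<le> C * norm x * (1/2)^k" for k
      using g(1)[of "X k"] mult_left_mono[OF X C(1), of k] by (simp add: mult.assoc)
    have geo: "(\<lambda>k. C * norm x * (1/2)^k) sums (C * norm x * 2)"
      using geometric_sums[of "1/2::real"] by (intro sums_mult) auto
    have norm_summable: "summable (\<lambda>k. norm (T (g (X k))))"
      using bound by (intro summable_comparison_test'[OF sums_summable[OF geo], of 0]) auto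
    have "(\<lambda>k. (1/2)^k) \<longlonglongrightarrow> (0::real)"
      by (rule LIMSEQ_power_zero) simp
    then have "(\<lambda>k. norm x * (1/2)^k) \<longlonglongrightarrow> 0"
      by (rule tendsto_mult_right_zero)
    then have "X \<longlonglongrightarrow> 0"
      by (rule Lim_null_comparison[rotated]) (simp add: X)
    then have "(\<lambda>k. x - X k) \<longlonglongrightarrow> x"
      using tendsto_diff[OF tendsto_const, of X 0 sequentially x] by simp
    moreover have "(\<lambda>k. T (x - X k)) \<longlonglongrightarrow> (\<Sum>k. T (g (X k)))"
      unfolding tele by (rule summable_LIMSEQ[OF summable_norm_cancel[OF norm_summable]])
    ultimately have "T x = (\<Sum>k. T (g (X k)))"
      by (rule closed)
    also have "norm \<dots> \<le> C * norm x * 2"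
      using norm_suminf_le[OF bound sums_summable[OF geo]] geo by (simp add: sums_iff)
    finally show ?thesis
      by (simp add: mult_ac)
  qed
  then show ?thesis
    by (intro bounded_linear_intro) (auto simp: add scale)
qed

section \<open>Operators between complex Hilbert spaces\<close>

instance chilbert_space \<subseteq> banach ..

section \<open>Arithmetic and continuity of complex scalars and inner products\<close>

lemma scaleC_zero_right [simp]: "c *\<^sub>C (0::'a::chilbert_space) = 0"
  using scaleC_add_right[of c 0 "0::'a"] by simp

lemma scaleC_minus_right: "c *\<^sub>C (- x) = - (c *\<^sub>C (x::'a::chilbert_space))"
  using scaleC_add_right[of c x "- x"] by (simp add: add_eq_0_iff2)

lemma scaleC_diff_right: "c *\<^sub>C (x - y) = c *\<^sub>C x - c *\<^sub>C (y::'a::chilbert_space)"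
  using scaleC_add_right[of c x "- y"] by (simp add: scaleC_minus_right)

lemma scaleC_scaleR_commute: "c *\<^sub>C (r *\<^sub>R x) = r *\<^sub>R (c *\<^sub>C (x::'a::chilbert_space))"
  by (simp add: scaleR_scaleC scaleC_scaleC mult.commute)

lemma cinner_add_right: "cinner x (y + w) = cinner x y + cinner x (w::'a::chilbert_space)"
  by (metis cinner_add_left cinner_commute complex_cnj_add)

lemma cinner_scaleC_right: "cinner x (c *\<^sub>C y) = cnj c * cinner x (y::'a::chilbert_space)"
  by (metis cinner_scaleC_left cinner_commute complex_cnj_mult)

lemma cinner_zero_left [simp]: "cinner 0 (y::'a::chilbert_space) = 0"
  using cinner_add_left[of 0 0 y] by simp

lemma cinner_zero_right [simp]: "cinner (y::'a::chilbert_space) 0 = 0"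
  using cinner_add_right[of y 0 0] by simp

lemma cinner_minus_left: "cinner (- x) y = - cinner x (y::'a::chilbert_space)"
  using cinner_add_left[of x "- x" y] by (simp add: add_eq_0_iff)

lemma cinner_minus_right: "cinner x (- y) = - cinner x (y::'a::chilbert_space)"
  using cinner_add_right[of x y "- y"] by (simp add: add_eq_0_iff)

lemma cinner_diff_left: "cinner (x - y) w = cinner x w - cinner y (w::'a::chilbert_space)"
  using cinner_add_left[of x "- y" w] by (simp add: cinner_minus_left)

lemma cinner_self_eq_0: "cinner x x = 0 \<longleftrightarrow> x = (0::'a::chilbert_space)"
  using inner_cinner[of x x] by force

text \<open>The imaginary part of a number is the real part of its product with -i. This reduces
  continuity of \<open>cinner\<close> to that of the real inner product.\<close>

lemma cinner_eq_Complex: "cinner x y = Complex (inner x y) (inner ((- \<i>) *\<^sub>C x) (y::'a::chilbert_space))"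
  by (simp add: inner_cinner cinner_scaleC_left complex_eq_iff)

lemma norm_scaleC: "norm (c *\<^sub>C x) = cmod c * norm (x::'a::chilbert_space)"
proof -
  have "cinner (c *\<^sub>C x) (c *\<^sub>C x) = (c * cnj c) * cinner x x"
    by (simp add: cinner_scaleC_left cinner_scaleC_right)
  also have "c * cnj c = complex_of_real ((cmod c)\<^sup>2)"
    by (rule complex_norm_square[symmetric])
  finally have "(norm (c *\<^sub>C x))\<^sup>2 = (cmod c)\<^sup>2 * (norm x)\<^sup>2"
    by (simp add: power2_norm_eq_inner[where 'a='a] inner_cinner)
  then show ?thesis
    by (simp flip: power_mult_distrib)
qed

lemma bounded_linear_scaleC: "bounded_linear (\<lambda>x::'a::chilbert_space. c *\<^sub>C x)"
  by (rule bounded_linear_intro[where K = "cmod c"])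
    (simp_all add: scaleC_add_right scaleC_scaleR_commute norm_scaleC)

lemmas tendsto_scaleC [tendsto_intros] = bounded_linear.tendsto[OF bounded_linear_scaleC]

lemma tendsto_cinner [tendsto_intros]:
  fixes f g :: "'b \<Rightarrow> 'a::chilbert_space"
  assumes "(f \<longlongrightarrow> x) F" "(g \<longlongrightarrow> y) F"
  shows "((\<lambda>t. cinner (f t) (g t)) \<longlongrightarrow> cinner x y) F"
  unfolding cinner_eq_Complex using assms by (intro tendsto_intros)

text \<open>The closed graph theorem for operators given by a relation: an everywhere defined,
  sequentially closed linear graph is the graph of a bounded operator. The one-sided inverses, the
  map \<open>\<gamma>\<close> and the operator \<open>\<Gamma>1 R0\<close> all get their boundedness
  from it.\<close>

lemma closed_graph_bounded_op:
  fixes G :: "('a::chilbert_space, 'b::chilbert_space) graph_op"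
  assumes G: "linear_op G" and dom: "\<And>x. x \<in> Domain G"
    and closed: "\<And>f g x y. (\<And>n. (f n, g n) \<in> G) \<Longrightarrow> f \<longlonglongrightarrow> x \<Longrightarrow> g \<longlonglongrightarrow> y \<Longrightarrow> (x, y) \<in> G"
  obtains T where "bounded_op T" "\<And>x y. (x, y) \<in> G \<longleftrightarrow> y = T x"
proof -
  have "\<forall>x. \<exists>y. (x, y) \<in> G"
    using dom by blast
  then obtain T where T: "(x, T x) \<in> G" for x
    by metis
  have iff: "(x, y) \<in> G \<longleftrightarrow> y = T x" for x y
    using G T by (metis linear_op_def single_valuedD)
  have scale: "T (c *\<^sub>C x) = c *\<^sub>C T x" for c x
    using G T iff by (metis linear_op_def)
  have "linear T"
    using G T iff by (intro linearI) (metis linear_op_def, metis scale scaleR_scaleC)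
  moreover have "T x = y" if "f \<longlonglongrightarrow> x" "(\<lambda>n. T (f n)) \<longlonglongrightarrow> y" for f x y
    using closed[OF T that] iff by simp
  ultimately have "bounded_op T"
    using closed_graph scale unfolding bounded_op_def by blast
  with iff show thesis
    using that by blast
qed

text \<open>The point \<open>p\<close> is the nearest point of \<open>L\<close> to \<open>x\<close>,
  found as the limit of a minimizing sequence. Orthogonality is the vanishing of the first variation
  of the distance at \<open>p\<close>.\<close>

lemma orthogonal_decomposition:
  fixes L :: "'a::chilbert_space set"
  assumes "closed L" "0 \<in> L" and add: "\<And>x y. x \<in> L \<Longrightarrow> y \<in> L \<Longrightarrow> x + y \<in> L"
    and scale: "\<And>c x. x \<in> L \<Longrightarrow> c *\<^sub>C x \<in> L"
  obtains p where "p \<in> L" "\<And>u. u \<in> L \<Longrightarrow> cinner (x - p) u = 0"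
proof -
  define d where "d = infdist x L"
  have d: "d \<le> norm (x - u)" if "u \<in> L" for u
    using infdist_le[OF that, of x] by (simp add: d_def dist_norm)
  have "\<exists>u\<in>L. norm (x - u) < d + inverse (real (Suc n))" for n
  proof -
    have "(INF a\<in>L. dist x a) < d + inverse (real (Suc n))"
      using \<open>0 \<in> L\<close> by (auto simp: d_def infdist_def)
    then show ?thesis
      using \<open>0 \<in> L\<close> by (subst (asm) cINF_less_iff) (auto simp flip: dist_norm)
  qed
  then obtain u where u: "u n \<in> L" "norm (x - u n) < d + inverse (real (Suc n))" for n
    by metis
  have scaleR: "r *\<^sub>R v \<in> L" if "v \<in> L" for r v
    using scale[OF that] by (simp add: scaleR_scaleC)
  have d0: "d \<ge> 0"
    by (simp add: d_def infdist_nonneg)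
  have par: "(norm (u m - u n))\<^sup>2 \<le> 2 * (norm (x - u m))\<^sup>2 + 2 * (norm (x - u n))\<^sup>2 - 4 * d\<^sup>2" for m n
  proof -
    \<comment> \<open>The midpoint is at distance at least \<open>d\<close> from \<open>x\<close>.
      The parallelogram law turns this into a bound on the distance between \<open>u m\<close> and
      \<open>u n\<close>.\<close>
    have "(1/2) *\<^sub>R (u m + u n) \<in> L"
      by (intro scaleR add u)
    then have "d\<^sup>2 \<le> (norm (x - (1/2) *\<^sub>R (u m + u n)))\<^sup>2"
      using d d0 by (intro power_mono) auto
    then show ?thesis
      by (simp add: power2_norm_eq_inner algebra_simps inner_commute)
  qed
  have lim: "(\<lambda>n. norm (x - u n)) \<longlonglongrightarrow> d"
  proof (rule tendsto_sandwich)
    show "\<forall>\<^sub>F n in sequentially. d \<le> norm (x - u n)"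
      using d u by simp
    show "\<forall>\<^sub>F n in sequentially. norm (x - u n) \<le> d + inverse (real (Suc n))"
      using u(2) by (simp add: less_imp_le)
    show "(\<lambda>n. d + inverse (real (Suc n))) \<longlonglongrightarrow> d"
      using LIMSEQ_inverse_real_of_nat_add by blast
  qed auto
  have "Cauchy u"
  proof (rule metric_CauchyI)
    fix e :: real
    assume e: "e > 0"
    have "(\<lambda>n. (norm (x - u n))\<^sup>2) \<longlonglongrightarrow> d\<^sup>2"
      by (intro tendsto_intros lim)
    \<comment> \<open>With the tolerance \<open>e\<^sup>2 / 4\<close> the terms with
      \<open>d\<close> cancel in \<open>par\<close>, and exactly \<open>e\<^sup>2\<close>
      remains.\<close>
    then have "\<forall>\<^sub>F n in sequentially. (norm (x - u n))\<^sup>2 < d\<^sup>2 + e\<^sup>2 / 4"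
      using e by (intro order_tendstoD) auto
    then obtain N where N: "\<And>n. n \<ge> N \<Longrightarrow> (norm (x - u n))\<^sup>2 < d\<^sup>2 + e\<^sup>2 / 4"
      by (auto simp: eventually_sequentially)
    have "dist (u m) (u n) < e" if "m \<ge> N" "n \<ge> N" for m n
    proof -
      have "(norm (u m - u n))\<^sup>2 < e\<^sup>2"
        using par[of m n] N[OF that(1)] N[OF that(2)] by simp
      then show ?thesis
        using e by (auto simp: dist_norm intro: power2_less_imp_less)
    qed
    then show "\<exists>M. \<forall>m\<ge>M. \<forall>n\<ge>M. dist (u m) (u n) < e"
      by blast
  qed
  then obtain p where p: "u \<longlonglongrightarrow> p"
    using Cauchy_convergent_iff convergent_def by blast
  have pL: "p \<in> L"
    using closed_sequentially[OF \<open>closed L\<close> _ p] u by blast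
  have np: "norm (x - p) = d"
    by (rule LIMSEQ_unique[OF tendsto_norm[OF tendsto_diff[OF tendsto_const p]] lim])
  have norm_diff_sq: "(norm (w - t *\<^sub>R v))\<^sup>2 = (norm w)\<^sup>2 - 2 * t * inner w v + t * t * inner v v"
    for w v :: 'a and t
    unfolding power2_norm_eq_inner
    by (simp add: inner_diff_left inner_diff_right inner_commute[of v w] right_diff_distrib)
  have re: "inner (x - p) v = 0" if "v \<in> L" for v
  proof (rule ccontr)
    assume nz: "inner (x - p) v \<noteq> 0"
    then have v: "inner v v > 0"
      by (auto simp: inner_gt_zero_iff)
    \<comment> \<open>This \<open>t\<close> minimizes the quadratic of \<open>norm_diff_sq\<close>;
      moving from \<open>p\<close> to \<open>p + t *\<^sub>R v\<close> would bring the distance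
      below \<open>d\<close>.\<close>
    define t where "t = inner (x - p) v / inner v v"
    have "d\<^sup>2 \<le> (norm (x - (p + t *\<^sub>R v)))\<^sup>2"
      using d0 by (intro power_mono d add pL scaleR that) auto
    also have "\<dots> = (norm ((x - p) - t *\<^sub>R v))\<^sup>2"
      by (simp add: diff_diff_eq)
    also have "\<dots> = d\<^sup>2 - 2 * t * inner (x - p) v + t * t * inner v v"
      unfolding norm_diff_sq np by simp
    also have "\<dots> = d\<^sup>2 - (inner (x - p) v)\<^sup>2 / inner v v"
      using v by (simp add: t_def power2_eq_square)
    also have "\<dots> < d\<^sup>2"
      using nz v by simp
    finally show False
      by simp
  qed
  \<comment> \<open>Real orthogonality to \<open>v\<close> kills the real part, and to
    \<open>\<i> *\<^sub>C v\<close> the imaginary part.\<close>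
  have "cinner (x - p) v = 0" if "v \<in> L" for v
    using re[OF that] re[OF scale[OF that, of \<i>]] unfolding inner_cinner cinner_scaleC_right
    by (simp add: complex_eq_iff)
  with pL show thesis
    using that by blast
qed

lemma bounded_op_simps:
  assumes "bounded_op T"
  shows "T (x + y) = T x + T y" "T (x - y) = T x - T y" "T 0 = 0" "T (c *\<^sub>C x) = c *\<^sub>C T x"
  using assms by (auto simp: bounded_op_def linear_simps)

lemma bounded_op_tendsto:
  assumes "bounded_op T" "f \<longlonglongrightarrow> x"
  shows "(\<lambda>n. T (f n)) \<longlonglongrightarrow> T x"
  using assms bounded_linear.tendsto unfolding bounded_op_def by blast

text \<open>\<open>L\<close> projects orthogonally onto the closed range and then inverts
  \<open>T\<close>. Saying in \<open>G\<close> that \<open>y - T x\<close> is orthogonal to the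
  range describes this by a condition that survives limits.\<close>

lemma bounded_op_left_inverse:
  fixes T :: "'a::chilbert_space \<Rightarrow> 'b::chilbert_space"
  assumes T: "bounded_op T" "inj T" "closed (range T)"
  obtains L where "bounded_op L" "\<And>x. L (T x) = x"
proof -
  note [simp] = bounded_op_simps[OF T(1)]
  define G where "G = {(y, x). \<forall>u. cinner (y - T x) (T u) = 0}"
  have "linear_op G"
    unfolding linear_op_def
  proof (intro conjI allI impI single_valuedI)
    fix y x x'
    assume *: "(y, x) \<in> G" "(y, x') \<in> G"
    \<comment> \<open>Subtracting the two identities shows that \<open>T (x - x')\<close> is
      orthogonal to itself.\<close>
    have "cinner (y - T x) (T (x - x')) = 0" "cinner (y - T x') (T (x - x')) = 0"
      using * unfolding G_def by blast+
    then have "cinner (T (x - x')) (T (x - x')) = 0"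
      by (simp add: cinner_diff_left)
    then have "T x = T x'"
      by (simp add: cinner_self_eq_0)
    then show "x = x'"
      using T(2) by (simp add: inj_eq)
  next
    fix y x y' x'
    assume "(y, x) \<in> G" "(y', x') \<in> G"
    then show "(y + y', x + x') \<in> G"
      by (simp add: G_def cinner_add_left cinner_diff_left)
  next
    fix c y x
    assume "(y, x) \<in> G"
    then show "(c *\<^sub>C y, c *\<^sub>C x) \<in> G"
      by (simp add: G_def cinner_scaleC_left flip: scaleC_diff_right)
  qed (simp add: G_def)
  moreover have "y \<in> Domain G" for y
  proof -
    obtain p where "p \<in> range T" "\<And>u. u \<in> range T \<Longrightarrow> cinner (y - p) u = 0"
    proof (rule orthogonal_decomposition[OF T(3), of y])
      show "0 \<in> range T"
        using rangeI[of T 0] by simp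
      show "a + b \<in> range T" if ab: "a \<in> range T" "b \<in> range T" for a b
      proof -
        obtain u v where "a = T u" "b = T v"
          using ab by blast
        then show ?thesis
          using rangeI[of T "u + v"] by simp
      qed
      show "c *\<^sub>C a \<in> range T" if a: "a \<in> range T" for c a
      proof -
        obtain u where "a = T u"
          using a by blast
        then show ?thesis
          using rangeI[of T "c *\<^sub>C u"] by simp
      qed
    qed blast
    then show ?thesis
      by (auto simp: G_def Domain_iff)
  qed
  moreover have "(y, x) \<in> G"
    if "\<And>n. (g n, f n) \<in> G" "g \<longlonglongrightarrow> y" "f \<longlonglongrightarrow> x" for f g x y
  proof -
    have "cinner (y - T x) (T u) = 0" for u
    proof (rule LIMSEQ_unique)
      show "(\<lambda>n. cinner (g n - T (f n)) (T u)) \<longlonglongrightarrow> cinner (y - T x) (T u)"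
        by (intro tendsto_intros that bounded_op_tendsto[OF T(1)])
      show "(\<lambda>n. cinner (g n - T (f n)) (T u)) \<longlonglongrightarrow> 0"
        using that(1) by (simp add: G_def)
    qed
    then show ?thesis
      by (simp add: G_def)
  qed
  ultimately obtain L where L: "bounded_op L" "\<And>x y. (x, y) \<in> G \<longleftrightarrow> y = L x"
    using closed_graph_bounded_op[of G] by blast
  have "(T x, x) \<in> G" for x
    by (simp add: G_def)
  with L show thesis
    using that by metis
qed

text \<open>\<open>S\<close> selects the preimage orthogonal to the kernel of \<open>T\<close>. It
  is unique, depends linearly on \<open>y\<close>, and is obtained by removing from any preimage its
  projection onto the kernel.\<close>

lemma bounded_op_right_inverse:
  fixes T :: "'a::chilbert_space \<Rightarrow> 'b::chilbert_space"
  assumes T: "bounded_op T" "surj T"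
  obtains S where "bounded_op S" "\<And>y. T (S y) = y"
proof -
  note [simp] = bounded_op_simps[OF T(1)]
  define G where "G = {(y, x). T x = y \<and> (\<forall>u. T u = 0 \<longrightarrow> cinner x u = 0)}"
  have "linear_op G"
    unfolding linear_op_def
  proof (intro conjI allI impI single_valuedI)
    fix y x x'
    assume *: "(y, x) \<in> G" "(y, x') \<in> G"
    then have "T (x - x') = 0"
      by (simp add: G_def)
    then have "cinner (x - x') (x - x') = 0"
      using * by (simp add: G_def cinner_diff_left)
    then show "x = x'"
      by (simp add: cinner_self_eq_0)
  qed (auto simp: G_def cinner_add_left cinner_scaleC_left)
  moreover have "y \<in> Domain G" for y
  proof -
    obtain x where x: "T x = y"
      using T(2) by (metis surjD)
    have "closed {u. T u = 0}"
      using T(1) by (intro closed_Collect_eq continuous_on_const)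
        (simp add: bounded_op_def linear_continuous_on)
    then obtain p where "T p = 0" "\<And>u. T u = 0 \<Longrightarrow> cinner (x - p) u = 0"
      by (rule orthogonal_decomposition[of _ x]) auto
    then have "(y, x - p) \<in> G"
      using x by (simp add: G_def)
    then show ?thesis
      by blast
  qed
  moreover have "(y, x) \<in> G"
    if "\<And>n. (g n, f n) \<in> G" "g \<longlonglongrightarrow> y" "f \<longlonglongrightarrow> x" for f g x y
  proof -
    have "g = (\<lambda>n. T (f n))"
      using that(1) by (simp add: G_def fun_eq_iff)
    then have "T x = y"
      using LIMSEQ_unique[OF that(2)] bounded_op_tendsto[OF T(1) that(3)] by simp
    moreover have "cinner x u = 0" if "T u = 0" for u
    proof (rule LIMSEQ_unique)
      show "(\<lambda>n. cinner (f n) u) \<longlonglongrightarrow> cinner x u"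
        by (intro tendsto_intros \<open>f \<longlonglongrightarrow> x\<close>)
      show "(\<lambda>n. cinner (f n) u) \<longlonglongrightarrow> 0"
        using \<open>\<And>n. (g n, f n) \<in> G\<close> that by (simp add: G_def)
    qed
    ultimately show ?thesis
      by (simp add: G_def)
  qed
  ultimately obtain S where S: "bounded_op S" "\<And>x y. (x, y) \<in> G \<longleftrightarrow> y = S x"
    using closed_graph_bounded_op[of G] by blast
  then have "(y, S y) \<in> G" for y
    by blast
  then have "T (S y) = y" for y
    by (simp add: G_def)
  with S(1) show thesis
    by (rule that)
qed

section \<open>Krein's resolvent formula\<close>

lemma op_adjoint_iff:
  "(g, g') \<in> op_adjoint A \<longleftrightarrow> (\<forall>f f'. (f, f') \<in> A \<longrightarrow> cinner f' g = cinner f g')"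
  by (auto simp: op_adjoint_def)

lemma op_adjoint_add:
  "(f, f') \<in> op_adjoint A \<Longrightarrow> (g, g') \<in> op_adjoint A \<Longrightarrow> (f + g, f' + g') \<in> op_adjoint A"
  by (simp add: op_adjoint_iff cinner_add_right)

lemma op_adjoint_scale: "(f, f') \<in> op_adjoint A \<Longrightarrow> (c *\<^sub>C f, c *\<^sub>C f') \<in> op_adjoint A"
  by (simp add: op_adjoint_iff cinner_scaleC_right)

lemma op_adjoint_diff:
  "(f, f') \<in> op_adjoint A \<Longrightarrow> (g, g') \<in> op_adjoint A \<Longrightarrow> (f - g, f' - g') \<in> op_adjoint A"
  using op_adjoint_add[of f f' A "- g" "- g'"] by (simp add: op_adjoint_iff cinner_minus_right)

lemma op_adjoint_limit:
  assumes "\<And>n. (f n, f' n) \<in> op_adjoint A" "f \<longlonglongrightarrow> g" "f' \<longlonglongrightarrow> g'"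
  shows "(g, g') \<in> op_adjoint A"
proof -
  have "cinner a' g = cinner a g'" if "(a, a') \<in> A" for a a'
  proof (rule LIMSEQ_unique)
    show "(\<lambda>n. cinner a' (f n)) \<longlonglongrightarrow> cinner a' g"
      by (intro tendsto_intros assms)
    have "cinner a' (f n) = cinner a (f' n)" for n
      using assms(1)[of n] that by (simp add: op_adjoint_iff)
    moreover have "(\<lambda>n. cinner a (f' n)) \<longlonglongrightarrow> cinner a g'"
      by (intro tendsto_intros assms)
    ultimately show "(\<lambda>n. cinner a' (f n)) \<longlonglongrightarrow> cinner a g'"
      by simp
  qed
  then show ?thesis
    by (simp add: op_adjoint_iff)
qed

lemma op_diff_scalar_iff: "(f, y) \<in> op_diff T (scalar_op z) \<longleftrightarrow> (f, y + z *\<^sub>C f) \<in> T"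
  by (auto simp: op_diff_def scalar_op_def) (metis add_diff_cancel_right')

lemma resolvent_eqI:
  assumes "\<And>f y. (f, y) \<in> op_diff T (scalar_op z) \<longleftrightarrow> f = R y"
  shows "resolvent T z = R"
  using assms by (auto simp: resolvent_def op_inv_def)

text \<open>The equivalence for \<open>R0\<close> carries both existence and uniqueness for the
  equation \<open>(A\<^sub>0 - z) f = y\<close>: \<open>R0_adjoint\<close> and
  \<open>\<Gamma>0_R0\<close> use one direction, \<open>R0_eqI\<close> the other.\<close>

locale boundary_triplet_at =
  fixes A :: "('a::chilbert_space, 'a) graph_op"
    and \<Gamma>0 \<Gamma>1 :: "'a \<Rightarrow> 'h::chilbert_space"
    and z :: complex
    and R0 :: "'a \<Rightarrow> 'a"
  assumes triplet: "boundary_triplet A \<Gamma>0 \<Gamma>1"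
    and R0_bounded: "bounded_op R0"
    and R0_iff: "(f, y) \<in> op_diff (kernel_extension A \<Gamma>0) (scalar_op z) \<longleftrightarrow> f = R0 y"
begin

lemma R0_eqI: "(f, y + z *\<^sub>C f) \<in> op_adjoint A \<Longrightarrow> \<Gamma>0 f = 0 \<Longrightarrow> R0 y = f"
  using R0_iff[of f y] by (simp add: op_diff_scalar_iff kernel_extension_def)

lemma R0_adjoint: "(R0 y, y + z *\<^sub>C R0 y) \<in> op_adjoint A"
  and \<Gamma>0_R0: "\<Gamma>0 (R0 y) = 0"
  using R0_iff[of "R0 y" y] by (simp_all add: op_diff_scalar_iff kernel_extension_def)

section \<open>Linearity and closedness of the boundary maps\<close>

lemma \<Gamma>_add:
  assumes "(f, f') \<in> op_adjoint A" "(g, g') \<in> op_adjoint A"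
  shows "\<Gamma>0 (f + g) = \<Gamma>0 f + \<Gamma>0 g" "\<Gamma>1 (f + g) = \<Gamma>1 f + \<Gamma>1 g"
  using triplet assms unfolding boundary_triplet_def linear_map_on_def by blast+

lemma \<Gamma>_scale:
  assumes "(f, f') \<in> op_adjoint A"
  shows "\<Gamma>0 (c *\<^sub>C f) = c *\<^sub>C \<Gamma>0 f" "\<Gamma>1 (c *\<^sub>C f) = c *\<^sub>C \<Gamma>1 f"
  using triplet assms unfolding boundary_triplet_def linear_map_on_def by blast+

lemma \<Gamma>_diff:
  assumes "(f, f') \<in> op_adjoint A" "(g, g') \<in> op_adjoint A"
  shows "\<Gamma>0 (f - g) = \<Gamma>0 f - \<Gamma>0 g" "\<Gamma>1 (f - g) = \<Gamma>1 f - \<Gamma>1 g"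
  using \<Gamma>_add[OF op_adjoint_diff[OF assms] assms(2)] by simp_all

lemma green:
  assumes "(f, f') \<in> op_adjoint A" "(g, g') \<in> op_adjoint A"
  shows "cinner f' g - cinner f g' = cinner (\<Gamma>1 f) (\<Gamma>0 g) - cinner (\<Gamma>0 f) (\<Gamma>1 g)"
  using triplet assms unfolding boundary_triplet_def by blast

lemma boundary_values:
  obtains g g' where "(g, g') \<in> op_adjoint A" "\<Gamma>0 g = a" "\<Gamma>1 g = b"
proof -
  have "(b, a) \<in> (\<lambda>f. (\<Gamma>1 f, \<Gamma>0 f)) ` Domain (op_adjoint A)"
    using triplet by (simp add: boundary_triplet_def)
  then show thesis
    using that by auto
qed

text \<open>Tested against elements with prescribed boundary values, Green's identity makes both
  boundary maps weakly continuous with respect to the graph norm.\<close>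

lemma green_limit:
  assumes f: "\<And>n. (f n, f' n) \<in> op_adjoint A" "f \<longlonglongrightarrow> u" "f' \<longlonglongrightarrow> u'"
    and g: "(g, g') \<in> op_adjoint A"
  shows "(\<lambda>n. cinner (\<Gamma>1 (f n)) (\<Gamma>0 g) - cinner (\<Gamma>0 (f n)) (\<Gamma>1 g))
    \<longlonglongrightarrow> cinner (\<Gamma>1 u) (\<Gamma>0 g) - cinner (\<Gamma>0 u) (\<Gamma>1 g)"
proof -
  have "(\<lambda>n. cinner (f' n) g - cinner (f n) g') \<longlonglongrightarrow> cinner u' g - cinner u g'"
    by (intro tendsto_intros f)
  then show ?thesis
    by (simp add: green[OF f(1) g] green[OF op_adjoint_limit[OF f] g])
qed

text \<open>A test element with \<open>\<Gamma>0 g = 0\<close> removes the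
  \<open>\<Gamma>1 (f n)\<close> term from the weak limit. Taking \<open>\<Gamma>1 g\<close> to be
  the discrepancy \<open>\<Gamma>0 u - h\<close> then makes the discrepancy orthogonal to
  itself.\<close>

lemma \<Gamma>0_limit:
  assumes f: "\<And>n. (f n, f' n) \<in> op_adjoint A" "f \<longlonglongrightarrow> u" "f' \<longlonglongrightarrow> u'"
    and h: "(\<lambda>n. \<Gamma>0 (f n)) \<longlonglongrightarrow> h"
  shows "\<Gamma>0 u = h"
proof -
  obtain g g' where g: "(g, g') \<in> op_adjoint A" "\<Gamma>0 g = 0" "\<Gamma>1 g = \<Gamma>0 u - h"
    by (rule boundary_values)
  have "(\<lambda>n. - cinner (\<Gamma>0 (f n)) (\<Gamma>1 g)) \<longlonglongrightarrow> - cinner (\<Gamma>0 u) (\<Gamma>1 g)"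
    using green_limit[OF f g(1)] g(2) by simp
  moreover have "(\<lambda>n. - cinner (\<Gamma>0 (f n)) (\<Gamma>1 g)) \<longlonglongrightarrow> - cinner h (\<Gamma>1 g)"
    by (intro tendsto_intros h)
  ultimately have "cinner (\<Gamma>0 u) (\<Gamma>1 g) = cinner h (\<Gamma>1 g)"
    using LIMSEQ_unique by fastforce
  then have "cinner (\<Gamma>0 u - h) (\<Gamma>0 u - h) = 0"
    by (simp add: g cinner_diff_left)
  then show ?thesis
    by (simp add: cinner_self_eq_0)
qed

text \<open>The same argument with the roles of the boundary maps exchanged.\<close>

lemma \<Gamma>1_limit:
  assumes f: "\<And>n. (f n, f' n) \<in> op_adjoint A" "f \<longlonglongrightarrow> u" "f' \<longlonglongrightarrow> u'"
    and h: "(\<lambda>n. \<Gamma>1 (f n)) \<longlonglongrightarrow> h"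
  shows "\<Gamma>1 u = h"
proof -
  obtain g g' where g: "(g, g') \<in> op_adjoint A" "\<Gamma>0 g = \<Gamma>1 u - h" "\<Gamma>1 g = 0"
    by (rule boundary_values)
  have "(\<lambda>n. cinner (\<Gamma>1 (f n)) (\<Gamma>0 g)) \<longlonglongrightarrow> cinner (\<Gamma>1 u) (\<Gamma>0 g)"
    using green_limit[OF f g(1)] g(3) by simp
  moreover have "(\<lambda>n. cinner (\<Gamma>1 (f n)) (\<Gamma>0 g)) \<longlonglongrightarrow> cinner h (\<Gamma>0 g)"
    by (intro tendsto_intros h)
  ultimately have "cinner (\<Gamma>1 u) (\<Gamma>0 g) = cinner h (\<Gamma>0 g)"
    by (rule LIMSEQ_unique)
  then have "cinner (\<Gamma>1 u - h) (\<Gamma>1 u - h) = 0"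
    by (simp add: g cinner_diff_left)
  then show ?thesis
    by (simp add: cinner_self_eq_0)
qed

section \<open>The operators entering the resolvent formula\<close>

lemma defect_space_iff: "f \<in> defect_space A z \<longleftrightarrow> (f, z *\<^sub>C f) \<in> op_adjoint A"
  by (simp add: defect_space_def)

text \<open>The defect space is the range of \<open>\<gamma>\<close>, and a bounded left inverse of
  \<open>\<gamma>\<close> requires a closed range.\<close>

lemma closed_defect_space: "closed (defect_space A z)"
  unfolding closed_sequential_limits defect_space_iff
proof (intro allI impI; elim conjE)
  fix f u
  assume f: "\<forall>n. (f n, z *\<^sub>C f n) \<in> op_adjoint A" "f \<longlonglongrightarrow> u"
  show "(u, z *\<^sub>C u) \<in> op_adjoint A"
    by (rule op_adjoint_limit[OF _ f(2) tendsto_scaleC[OF f(2)]]) (use f(1) in blast)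
qed

text \<open>On the defect space \<open>\<Gamma>0\<close> is injective, since an element of its
  kernel there solves \<open>(A\<^sub>0 - z) f = 0\<close>. It is onto because any \<open>g\<close>
  can be moved into the defect space without changing \<open>\<Gamma>0 g\<close>. Closedness of
  \<open>\<Gamma>0\<close> makes the inverse bounded.\<close>

lemma gamma_field:
  obtains \<gamma> where "bounded_op \<gamma>" "\<And>h f. f \<in> defect_space A z \<and> \<Gamma>0 f = h \<longleftrightarrow> f = \<gamma> h"
proof -
  define G where "G = {(h, f). f \<in> defect_space A z \<and> \<Gamma>0 f = h}"
  have "linear_op G"
    unfolding linear_op_def
  proof (intro conjI allI impI single_valuedI)
    fix h f g
    assume "(h, f) \<in> G" "(h, g) \<in> G"
    then have "f \<in> defect_space A z" "g \<in> defect_space A z" "\<Gamma>0 f = \<Gamma>0 g"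
      by (auto simp: G_def)
    then have "(f - g, z *\<^sub>C (f - g)) \<in> op_adjoint A" "\<Gamma>0 (f - g) = 0"
      by (auto simp: defect_space_iff scaleC_diff_right \<Gamma>_diff intro: op_adjoint_diff)
    then have "R0 0 = f - g"
      by (intro R0_eqI) simp_all
    then show "f = g"
      using bounded_op_simps(3)[OF R0_bounded] by simp
  next
    show "(0, 0) \<in> G"
      using R0_eqI[of "R0 0" 0] \<Gamma>0_R0[of 0] R0_adjoint[of 0] bounded_op_simps(3)[OF R0_bounded]
      by (simp add: G_def defect_space_iff)
  next
    fix h f k g
    assume "(h, f) \<in> G" "(k, g) \<in> G"
    then show "(h + k, f + g) \<in> G"
      by (auto simp: G_def defect_space_iff scaleC_add_right \<Gamma>_add intro: op_adjoint_add)
  next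
    fix c h f
    assume "(h, f) \<in> G"
    then show "(c *\<^sub>C h, c *\<^sub>C f) \<in> G"
      using op_adjoint_scale[of f "z *\<^sub>C f" A c]
      by (auto simp: G_def defect_space_iff \<Gamma>_scale scaleC_scaleC mult.commute)
  qed
  moreover have "h \<in> Domain G" for h
  proof -
    obtain g g' where g: "(g, g') \<in> op_adjoint A" "\<Gamma>0 g = h"
      by (rule boundary_values)
    \<comment> \<open>\<open>f\<close> has the same image under \<open>A\<^sup>* - z\<close> as
      \<open>g\<close> but \<open>\<Gamma>0 f = 0\<close>, so \<open>g - f\<close> is the required
      defect element.\<close>
    define f where "f = R0 (g' - z *\<^sub>C g)"
    have f: "(f, (g' - z *\<^sub>C g) + z *\<^sub>C f) \<in> op_adjoint A" "\<Gamma>0 f = 0"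
      unfolding f_def by (rule R0_adjoint \<Gamma>0_R0)+
    have "g' - (g' - z *\<^sub>C g + z *\<^sub>C f) = z *\<^sub>C (g - f)"
      by (simp add: scaleC_diff_right)
    then have "(g - f, z *\<^sub>C (g - f)) \<in> op_adjoint A"
      using op_adjoint_diff[OF g(1) f(1)] by simp
    then have "(h, g - f) \<in> G"
      using \<Gamma>_diff(1)[OF g(1) f(1)] g(2) f(2) by (simp add: G_def defect_space_iff)
    then show ?thesis
      by blast
  qed
  moreover have "(h, u) \<in> G"
    if "\<And>n. (k n, f n) \<in> G" "k \<longlonglongrightarrow> h" "f \<longlonglongrightarrow> u" for k f h u
  proof -
    have k: "k = (\<lambda>n. \<Gamma>0 (f n))" and f: "\<And>n. (f n, z *\<^sub>C f n) \<in> op_adjoint A"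
      using that(1) by (auto simp: G_def defect_space_iff)
    have lim: "(\<lambda>n. z *\<^sub>C f n) \<longlonglongrightarrow> z *\<^sub>C u"
      by (intro tendsto_intros that)
    have "\<Gamma>0 u = h"
      using \<Gamma>0_limit[OF f that(3) lim] that(2) k by blast
    then show ?thesis
      using op_adjoint_limit[OF f that(3) lim] by (simp add: G_def defect_space_iff)
  qed
  ultimately obtain \<gamma> where "bounded_op \<gamma>" "\<And>h f. (h, f) \<in> G \<longleftrightarrow> f = \<gamma> h"
    using closed_graph_bounded_op[of G] by blast
  then show thesis
    using that by (simp add: G_def)
qed

text \<open>If \<open>g n\<close> converges, so do both \<open>R0 (g n)\<close> and its image
  \<open>g n + z *\<^sub>C R0 (g n)\<close> under the adjoint. This is the graph convergence for
  which \<open>\<Gamma>1\<close> is closed.\<close>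

lemma \<Gamma>1_R0_bounded: "bounded_op (\<lambda>y. \<Gamma>1 (R0 y))"
proof -
  define G where "G = {(y, \<Gamma>1 (R0 y)) | y. True}"
  note R0 = bounded_op_simps[OF R0_bounded]
  have "linear_op G"
    unfolding linear_op_def
  proof (intro conjI allI impI single_valuedI)
    show "(0, 0) \<in> G"
      using \<Gamma>_diff(2)[OF R0_adjoint[of 0] R0_adjoint[of 0]] R0(3) by (simp add: G_def)
  next
    fix y k y' k'
    assume "(y, k) \<in> G" "(y', k') \<in> G"
    then show "(y + y', k + k') \<in> G"
      by (auto simp: G_def R0 \<Gamma>_add[OF R0_adjoint R0_adjoint])
  next
    fix c y k
    assume "(y, k) \<in> G"
    then show "(c *\<^sub>C y, c *\<^sub>C k) \<in> G"
      by (auto simp: G_def R0 \<Gamma>_scale[OF R0_adjoint])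
  qed (auto simp: G_def)
  moreover have "y \<in> Domain G" for y
    by (auto simp: G_def)
  moreover have "(y, k) \<in> G"
    if "\<And>n. (g n, l n) \<in> G" "g \<longlonglongrightarrow> y" "l \<longlonglongrightarrow> k" for g l y k
  proof -
    have l: "l = (\<lambda>n. \<Gamma>1 (R0 (g n)))"
      using that(1) by (auto simp: G_def)
    have R0_lim: "(\<lambda>n. R0 (g n)) \<longlonglongrightarrow> R0 y"
      by (rule bounded_op_tendsto[OF R0_bounded that(2)])
    then have "(\<lambda>n. g n + z *\<^sub>C R0 (g n)) \<longlonglongrightarrow> y + z *\<^sub>C R0 y"
      by (intro tendsto_intros that)
    then have "\<Gamma>1 (R0 y) = k"
      using \<Gamma>1_limit[OF R0_adjoint R0_lim] that(3) l by blast
    then show ?thesis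
      by (auto simp: G_def)
  qed
  ultimately obtain Q where Q: "bounded_op Q" "\<And>y k. (y, k) \<in> G \<longleftrightarrow> k = Q y"
    using closed_graph_bounded_op[of G] by blast
  have "Q = (\<lambda>y. \<Gamma>1 (R0 y))"
    using Q(2) by (auto simp: G_def)
  with Q(1) show ?thesis
    by simp
qed

text \<open>Any \<open>k\<close> is \<open>\<Gamma>1 f\<close> for some \<open>f\<close> with
  \<open>\<Gamma>0 f = 0\<close>; such an \<open>f\<close> is in the domain of
  \<open>A\<^sub>0\<close>, hence in the range of \<open>R0\<close>.\<close>

lemma surj_\<Gamma>1_R0: "surj (\<lambda>y. \<Gamma>1 (R0 y))"
proof -
  have "\<exists>y. \<Gamma>1 (R0 y) = k" for k
  proof -
    obtain f f' where f: "(f, f') \<in> op_adjoint A" "\<Gamma>0 f = 0" "\<Gamma>1 f = k"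
      by (rule boundary_values)
    then have "R0 (f' - z *\<^sub>C f) = f"
      by (intro R0_eqI) simp_all
    then show ?thesis
      using f(3) by (intro exI[of _ "f' - z *\<^sub>C f"]) simp
  qed
  then show ?thesis
    by (metis surjI)
qed

text \<open>Since \<open>op_inv\<close> is a definite description, the point is that
  \<open>\<Gamma>0 (R y)\<close> is the only \<open>h\<close> that \<open>B - M(z)\<close> sends to
  \<open>\<Gamma>1 (R0 y)\<close>. Existence is the boundary condition of \<open>R y\<close>;
  uniqueness follows by rebuilding a solution of \<open>(A\<^sub>B - z) f = y\<close> from
  \<open>h\<close>.\<close>

lemma krein_resolvent_formula:
  assumes \<gamma>: "bounded_op \<gamma>" "\<And>h f. f \<in> defect_space A z \<and> \<Gamma>0 f = h \<longleftrightarrow> f = \<gamma> h"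
    and z: "z \<in> resolvent_set (extension_by A \<Gamma>0 \<Gamma>1 B)"
  shows "resolvent (extension_by A \<Gamma>0 \<Gamma>1 B) z y
    = R0 y + \<gamma> (op_inv (op_diff B (weyl_function A \<Gamma>0 \<Gamma>1 z)) (\<Gamma>1 (R0 y)))"
proof -
  let ?M = "weyl_function A \<Gamma>0 \<Gamma>1 z"
  obtain R where R: "(f, y) \<in> op_diff (extension_by A \<Gamma>0 \<Gamma>1 B) (scalar_op z) \<longleftrightarrow> f = R y" for f y
    using z by (auto simp: resolvent_set_def)
  have \<gamma>_defect: "(\<gamma> h, z *\<^sub>C \<gamma> h) \<in> op_adjoint A" "\<Gamma>0 (\<gamma> h) = h" for h
    using \<gamma>(2)[of "\<gamma> h" h] by (simp_all add: defect_space_iff)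
  have Ry: "(R y, y + z *\<^sub>C R y) \<in> op_adjoint A" "(\<Gamma>0 (R y), \<Gamma>1 (R y)) \<in> B"
    using R[of "R y" y] by (simp_all add: op_diff_scalar_iff extension_by_def)
  \<comment> \<open>\<open>R y\<close> and \<open>R0 y\<close> solve the same inhomogeneous equation
    for the adjoint, so their difference is a defect element.\<close>
  have "(y + z *\<^sub>C R y) - (y + z *\<^sub>C R0 y) = z *\<^sub>C (R y - R0 y)"
    by (simp add: scaleC_diff_right)
  then have "R y - R0 y \<in> defect_space A z"
    using op_adjoint_diff[OF Ry(1) R0_adjoint[of y]] by (simp add: defect_space_iff)
  moreover have "\<Gamma>0 (R y - R0 y) = \<Gamma>0 (R y)"
    using \<Gamma>_diff(1)[OF Ry(1) R0_adjoint[of y]] by (simp add: \<Gamma>0_R0)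
  ultimately have "R y - R0 y = \<gamma> (\<Gamma>0 (R y))"
    using \<gamma>(2) by blast
  then have eq: "R y = R0 y + \<gamma> (\<Gamma>0 (R y))"
    by (simp add: algebra_simps)
  have "\<Gamma>1 (R y) = \<Gamma>1 (R0 y) + \<Gamma>1 (\<gamma> (\<Gamma>0 (R y)))"
    using \<Gamma>_add(2)[OF R0_adjoint[of y] \<gamma>_defect(1)[of "\<Gamma>0 (R y)"]] eq by simp
  moreover have "(\<Gamma>0 (R y), \<Gamma>1 (\<gamma> (\<Gamma>0 (R y)))) \<in> ?M"
    using \<gamma>_defect[of "\<Gamma>0 (R y)"] unfolding weyl_function_def defect_space_def
    by (metis (mono_tags, lifting) mem_Collect_eq)
  ultimately have mem: "(\<Gamma>0 (R y), \<Gamma>1 (R0 y)) \<in> op_diff B ?M"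
    using Ry(2) unfolding op_diff_def by (metis (mono_tags, lifting) add_diff_cancel_right' mem_Collect_eq)
  have "h = \<Gamma>0 (R y)" if h: "(h, \<Gamma>1 (R0 y)) \<in> op_diff B ?M" for h
  proof -
    obtain s t where st: "(h, s) \<in> B" "(h, t) \<in> ?M" "\<Gamma>1 (R0 y) = s - t"
      using h unfolding op_diff_def by blast
    then obtain g where "h = \<Gamma>0 g" "t = \<Gamma>1 g" "g \<in> defect_space A z"
      unfolding weyl_function_def by blast
    with st have s: "(h, s) \<in> B" "\<Gamma>1 (R0 y) = s - \<Gamma>1 g" "h = \<Gamma>0 g" "(g, z *\<^sub>C g) \<in> op_adjoint A"
      by (simp_all add: defect_space_iff)
    \<comment> \<open>\<open>R0 y + g\<close> solves the equation and satisfies the boundary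
      condition of \<open>B\<close>, so it must be \<open>R y\<close>; applying
      \<open>\<Gamma>0\<close> recovers \<open>h\<close>.\<close>
    have "(R0 y + g, (y + z *\<^sub>C R0 y) + z *\<^sub>C g) \<in> op_adjoint A"
      by (rule op_adjoint_add[OF R0_adjoint s(4)])
    moreover have "(\<Gamma>0 (R0 y + g), \<Gamma>1 (R0 y + g)) \<in> B"
      using s by (simp add: \<Gamma>_add[OF R0_adjoint s(4)] \<Gamma>0_R0)
    ultimately have "R0 y + g = R y"
      using R[of "R0 y + g" y] by (simp add: op_diff_scalar_iff extension_by_def scaleC_add_right add.assoc)
    then show ?thesis
      using \<Gamma>_add(1)[OF R0_adjoint[of y] s(4)] s(3) by (simp add: \<Gamma>0_R0)
  qed
  with mem have "op_inv (op_diff B ?M) (\<Gamma>1 (R0 y)) = \<Gamma>0 (R y)"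
    unfolding op_inv_def by blast
  with eq show ?thesis
    using resolvent_eqI[OF R] by simp
qed

end

theorem proposition4p5:
  fixes A :: "('a::chilbert_space, 'a) graph_op"
    and \<Gamma>0 \<Gamma>1 :: "'a \<Rightarrow> 'h::chilbert_space"
    and B1 B2 :: "('h, 'h) graph_op"
    and z :: complex
    and SH :: "('a \<Rightarrow> 'a) set"
    and Sh :: "('h \<Rightarrow> 'h) set"
  assumes "separable_space (euclidean :: 'a topology)"
    and "closed_densely_defined A"
    and "symmetric_op A"
    and "equal_deficiency_indices A"
    and "boundary_triplet A \<Gamma>0 \<Gamma>1"
    and "operator_ideal_on SH Sh"
    and "closed_densely_defined B1"
    and "closed_densely_defined B2"
    and "almost_solvable TYPE('k1::chilbert_space) A (extension_by A \<Gamma>0 \<Gamma>1 B1)"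
    and "almost_solvable TYPE('k2::chilbert_space) A (extension_by A \<Gamma>0 \<Gamma>1 B2)"
    and "z \<in> resolvent_set (extension_by A \<Gamma>0 \<Gamma>1 B1)"
    and "z \<in> resolvent_set (extension_by A \<Gamma>0 \<Gamma>1 B2)"
    and "z \<in> resolvent_set (kernel_extension A \<Gamma>0)"
  shows "(\<lambda>x. resolvent (extension_by A \<Gamma>0 \<Gamma>1 B1) z x
            - resolvent (extension_by A \<Gamma>0 \<Gamma>1 B2) z x) \<in> SH
     \<longleftrightarrow> (\<lambda>y. op_inv (op_diff B1 (weyl_function A \<Gamma>0 \<Gamma>1 z)) y
            - op_inv (op_diff B2 (weyl_function A \<Gamma>0 \<Gamma>1 z)) y) \<in> Sh"
    (is "?D \<in> SH \<longleftrightarrow> ?d \<in> Sh")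
proof -
  obtain R0 where R0: "bounded_op R0"
      "\<And>f y. (f, y) \<in> op_diff (kernel_extension A \<Gamma>0) (scalar_op z) \<longleftrightarrow> f = R0 y"
    using assms(13) by (auto simp: resolvent_set_def)
  interpret boundary_triplet_at A \<Gamma>0 \<Gamma>1 z R0
    using assms(5) R0 by unfold_locales
  obtain \<gamma> where \<gamma>: "bounded_op \<gamma>" "\<And>h f. f \<in> defect_space A z \<and> \<Gamma>0 f = h \<longleftrightarrow> f = \<gamma> h"
    using gamma_field by blast
  define Q where "Q = (\<lambda>y. \<Gamma>1 (R0 y))"
  have Q: "bounded_op Q" "surj Q"
    unfolding Q_def by (rule \<Gamma>1_R0_bounded surj_\<Gamma>1_R0)+
  have "inj \<gamma>"
    using \<gamma>(2) by (metis injI)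
  moreover have "range \<gamma> = defect_space A z"
    by (intro equalityI subsetI) (metis \<gamma>(2) rangeE, metis \<gamma>(2) rangeI)
  ultimately obtain L where L: "bounded_op L" "\<And>h. L (\<gamma> h) = h"
    using bounded_op_left_inverse[OF \<gamma>(1)] closed_defect_space by metis
  obtain S where S: "bounded_op S" "\<And>k. Q (S k) = k"
    using bounded_op_right_inverse[OF Q] by blast
  \<comment> \<open>The \<open>R0\<close> terms cancel. This is an identity of functions, so it is
    available before either side is known to lie in an ideal.\<close>
  have D: "?D = \<gamma> \<circ> ?d \<circ> Q"
    using krein_resolvent_formula[OF \<gamma> assms(11)] krein_resolvent_formula[OF \<gamma> assms(12)]
    by (simp add: fun_eq_iff Q_def bounded_op_simps[OF \<gamma>(1)])
  then have d: "?d = L \<circ> ?D \<circ> S"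
    by (simp add: fun_eq_iff L S)
  have transfer: "ideal_transfer SH Sh" "ideal_transfer Sh SH"
    using assms(6) by (auto simp: operator_ideal_on_def)
  show ?thesis
  proof
    assume "?D \<in> SH"
    then have "L \<circ> ?D \<circ> S \<in> Sh"
      using transfer(1) L(1) S(1) unfolding ideal_transfer_def by blast
    then show "?d \<in> Sh"
      by (simp only: d)
  next
    assume "?d \<in> Sh"
    then have "\<gamma> \<circ> ?d \<circ> Q \<in> SH"
      using transfer(2) \<gamma>(1) Q(1) unfolding ideal_transfer_def by blast
    then show "?D \<in> SH"
      by (simp only: D)
  qed
qed

end
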